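(* $VW_0\le_I VWDI$; that is, the first-order theory $VW_0$ is interpretable in the first-order theory $VWDI$ (both defined in the context).
   Context: $T\le_I S$ means that $T$ is (relatively) formally interpretable in $S$ in the usual sense. Both theories include the usual axioms for identity. Strings: $\Sigma^*$ is the set of finite words over $\{1,2\}$, including the empty word $e$; $s^{-1}$ is the reversal of $s$; $s\sqsubseteq t$ between strings means $s$ is an initial segment of $t$, and $s\sqsupseteq t$ means $s$ is an end segment of $t$ (both possibly improper). $D=\{1,2\}$. The same symbols are used for binary relation symbols. Both vocabularies contain a constant $\underline{s}$ for each $s\in\Sigma^*$. Write $x\sqsubset y$ for $x\sqsubseteq y\ \&\ x\ne y$ and $x\sqsupset y$ for $x\sqsupseteq y\ \&\ x\ne y$. (VW10) is the axiom $\forall x,y(x\sqsubseteq y\ \&\ y\sqsubseteq x\to x=y)$. $VW_0$: vocabulary: the constants $\underline{s}$ and the binary relation symbols $\sqsubseteq,\sqsupseteq$. Axioms: ($VW_0$1) $\neg\,\underline{s}=\underline{t}$ for distinct $s,t\in\Sigma^*$; ($VW_0$2) $\forall x(x\sqsubseteq\underline{t}\leftrightarrow\bigvee_{s\sqsubseteq t}x=\underline{s})$ for $t\in\Sigma^*$; ($VW_0$3) $\forall x(x\sqsupseteq\underline{t}\leftrightarrow\bigvee_{s\sqsupseteq t}x=\underline{s})$ for $t\in\Sigma^*$; ($VW_0$4) $\forall x\big(\forall y(y\sqsubset x\leftrightarrow y\sqsubset\underline{t})\to\bigwedge_{d\in D}(\underline{d}\sqsupseteq x\ \&\ \underline{d}\sqsupseteq\underline{t}\to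 x=\underline{t})\big)$ for $t\in\Sigma^*$; ($VW_0$5) $\forall x\big(\forall y(y\sqsupset x\leftrightarrow y\sqsupset\underline{t})\to\bigwedge_{d\in D}(\underline{d}\sqsubseteq x\ \&\ \underline{d}\sqsubseteq\underline{t}\to x=\underline{t})\big)$ for $t\in\Sigma^*$; and (VW10). $VWDI$: vocabulary: the constants $\underline{s}$, a unary function symbol $f$ and the binary relation symbol $\sqsubseteq$. Axioms: (VWDI1) $\neg\,\underline{s}=\underline{t}$ for distinct $s,t\in\Sigma^*$; (VWDI2) $f(\underline{s})=\underline{s^{-1}}$ for $s\in\Sigma^*$; (VWDI3) $\forall x(x\sqsubseteq\underline{t}\leftrightarrow\bigvee_{s\sqsubseteq t}x=\underline{s})$ for $t\in\Sigma^*$; (VWDI4) $\forall x\,f(f(x))=x$; (VWDI5) $\forall x\big(\forall y(y\sqsubset x\leftrightarrow y\sqsubset\underline{t})\to\bigwedge_{d\in D}(\underline{d}\sqsubseteq f(x)\ \&\ \underline{d}\sqsubseteq f(\underline{t})\to x=\underline{t})\big)$ for $t\in\Sigma^*$; and (VW10). *)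

theory Defs
  imports Main "HOL-Library.Sublist"
begin

section \<open>First-order syntax with equality (de Bruijn indices)\<close>

datatype 'f tm = Var nat | Fn 'f "'f tm list"

datatype ('f, 'p) fm =
    Falsum
  | Equal "'f tm" "'f tm"
  | Rel 'p "'f tm list"
  | Imp "('f, 'p) fm" "('f, 'p) fm"
  | And "('f, 'p) fm" "('f, 'p) fm"
  | Or "('f, 'p) fm" "('f, 'p) fm"
  | Forall "('f, 'p) fm"
  | Exists "('f, 'p) fm"

abbreviation Neg :: "('f, 'p) fm \<Rightarrow> ('f, 'p) fm" where
  "Neg \<phi> \<equiv> Imp \<phi> Falsum"

abbreviation Iff :: "('f, 'p) fm \<Rightarrow> ('f, 'p) fm \<Rightarrow> ('f, 'p) fm" where
  "Iff \<phi> \<psi> \<equiv> And (Imp \<phi> \<psi>) (Imp \<psi> \<phi>)"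

definition Conjs :: "('f, 'p) fm list \<Rightarrow> ('f, 'p) fm" where
  "Conjs \<phi>s = foldr And \<phi>s (Neg Falsum)"

definition Disjs :: "('f, 'p) fm list \<Rightarrow> ('f, 'p) fm" where
  "Disjs \<phi>s = foldr Or \<phi>s Falsum"

text \<open>The types of function and relation symbols are exactly the vocabulary;
  constants are function symbols of arity 0.\<close>

record ('f, 'p) signature =
  fun_arity :: "'f \<Rightarrow> nat"
  rel_arity :: "'p \<Rightarrow> nat"

primrec wf_tm :: "('f, 'p) signature \<Rightarrow> 'f tm \<Rightarrow> bool" where
  "wf_tm L (Var i) \<longleftrightarrow> True"
| "wf_tm L (Fn f ts) \<longleftrightarrow> length ts = fun_arity L f \<and> list_all (wf_tm L) ts"

primrec wf_fm :: "('f, 'p) signature \<Rightarrow> ('f, 'p) fm \<Rightarrow> bool" where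
  "wf_fm L Falsum \<longleftrightarrow> True"
| "wf_fm L (Equal s t) \<longleftrightarrow> wf_tm L s \<and> wf_tm L t"
| "wf_fm L (Rel p ts) \<longleftrightarrow> length ts = rel_arity L p \<and> list_all (wf_tm L) ts"
| "wf_fm L (Imp \<phi> \<psi>) \<longleftrightarrow> wf_fm L \<phi> \<and> wf_fm L \<psi>"
| "wf_fm L (And \<phi> \<psi>) \<longleftrightarrow> wf_fm L \<phi> \<and> wf_fm L \<psi>"
| "wf_fm L (Or \<phi> \<psi>) \<longleftrightarrow> wf_fm L \<phi> \<and> wf_fm L \<psi>"
| "wf_fm L (Forall \<phi>) \<longleftrightarrow> wf_fm L \<phi>"
| "wf_fm L (Exists \<phi>) \<longleftrightarrow> wf_fm L \<phi>"

primrec fv_tm :: "'f tm \<Rightarrow> nat set" where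
  "fv_tm (Var i) = {i}"
| "fv_tm (Fn f ts) = \<Union> (set (map fv_tm ts))"

primrec fv_fm :: "('f, 'p) fm \<Rightarrow> nat set" where
  "fv_fm Falsum = {}"
| "fv_fm (Equal s t) = fv_tm s \<union> fv_tm t"
| "fv_fm (Rel p ts) = \<Union> (fv_tm ` set ts)"
| "fv_fm (Imp \<phi> \<psi>) = fv_fm \<phi> \<union> fv_fm \<psi>"
| "fv_fm (And \<phi> \<psi>) = fv_fm \<phi> \<union> fv_fm \<psi>"
| "fv_fm (Or \<phi> \<psi>) = fv_fm \<phi> \<union> fv_fm \<psi>"
| "fv_fm (Forall \<phi>) = {i. Suc i \<in> fv_fm \<phi>}"
| "fv_fm (Exists \<phi>) = {i. Suc i \<in> fv_fm \<phi>}"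

primrec subst_tm :: "(nat \<Rightarrow> 'f tm) \<Rightarrow> 'f tm \<Rightarrow> 'f tm" where
  "subst_tm \<sigma> (Var i) = \<sigma> i"
| "subst_tm \<sigma> (Fn f ts) = Fn f (map (subst_tm \<sigma>) ts)"

definition up :: "(nat \<Rightarrow> 'f tm) \<Rightarrow> nat \<Rightarrow> 'f tm" where
  "up \<sigma> = case_nat (Var 0) (\<lambda>i. subst_tm (\<lambda>j. Var (Suc j)) (\<sigma> i))"

primrec subst_fm :: "(nat \<Rightarrow> 'f tm) \<Rightarrow> ('f, 'p) fm \<Rightarrow> ('f, 'p) fm" where
  "subst_fm \<sigma> Falsum = Falsum"
| "subst_fm \<sigma> (Equal s t) = Equal (subst_tm \<sigma> s) (subst_tm \<sigma> t)"
| "subst_fm \<sigma> (Rel p ts) = Rel p (map (subst_tm \<sigma>) ts)"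
| "subst_fm \<sigma> (Imp \<phi> \<psi>) = Imp (subst_fm \<sigma> \<phi>) (subst_fm \<sigma> \<psi>)"
| "subst_fm \<sigma> (And \<phi> \<psi>) = And (subst_fm \<sigma> \<phi>) (subst_fm \<sigma> \<psi>)"
| "subst_fm \<sigma> (Or \<phi> \<psi>) = Or (subst_fm \<sigma> \<phi>) (subst_fm \<sigma> \<psi>)"
| "subst_fm \<sigma> (Forall \<phi>) = Forall (subst_fm (up \<sigma>) \<phi>)"
| "subst_fm \<sigma> (Exists \<phi>) = Exists (subst_fm (up \<sigma>) \<phi>)"

definition rename :: "(nat \<Rightarrow> nat) \<Rightarrow> ('f, 'p) fm \<Rightarrow> ('f, 'p) fm" where
  "rename \<rho> = subst_fm (\<lambda>i. Var (\<rho> i))"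

abbreviation shift :: "('f, 'p) fm \<Rightarrow> ('f, 'p) fm" where
  "shift \<equiv> rename Suc"

definition inst :: "'f tm \<Rightarrow> ('f, 'p) fm \<Rightarrow> ('f, 'p) fm" where
  "inst t = subst_fm (case_nat t Var)"


section \<open>Classical natural deduction with equality\<close>

text \<open>The well-formedness side conditions keep every formula of a derivation inside the
  language \<open>L\<close>. In \<open>AllI\<close> and \<open>ExE\<close> shifting the context frees index 0, which then
  serves as the eigenvariable.\<close>

inductive derives :: "('f, 'p) signature \<Rightarrow> ('f, 'p) fm set \<Rightarrow> ('f, 'p) fm \<Rightarrow> bool"
  for L :: "('f, 'p) signature" where
  Assm: "\<phi> \<in> \<Gamma> \<Longrightarrow> wf_fm L \<phi> \<Longrightarrow> derives L \<Gamma> \<phi>"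
| Classical: "wf_fm L \<phi> \<Longrightarrow> derives L (insert (Neg \<phi>) \<Gamma>) Falsum \<Longrightarrow> derives L \<Gamma> \<phi>"
| ImpI: "wf_fm L \<phi> \<Longrightarrow> derives L (insert \<phi> \<Gamma>) \<psi> \<Longrightarrow> derives L \<Gamma> (Imp \<phi> \<psi>)"
| ImpE: "derives L \<Gamma> (Imp \<phi> \<psi>) \<Longrightarrow> derives L \<Gamma> \<phi> \<Longrightarrow> derives L \<Gamma> \<psi>"
| AndI: "derives L \<Gamma> \<phi> \<Longrightarrow> derives L \<Gamma> \<psi> \<Longrightarrow> derives L \<Gamma> (And \<phi> \<psi>)"
| AndE1: "derives L \<Gamma> (And \<phi> \<psi>) \<Longrightarrow> derives L \<Gamma> \<phi>"
| AndE2: "derives L \<Gamma> (And \<phi> \<psi>) \<Longrightarrow> derives L \<Gamma> \<psi>"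
| OrI1: "wf_fm L \<psi> \<Longrightarrow> derives L \<Gamma> \<phi> \<Longrightarrow> derives L \<Gamma> (Or \<phi> \<psi>)"
| OrI2: "wf_fm L \<phi> \<Longrightarrow> derives L \<Gamma> \<psi> \<Longrightarrow> derives L \<Gamma> (Or \<phi> \<psi>)"
| OrE: "derives L \<Gamma> (Or \<phi> \<psi>) \<Longrightarrow> derives L (insert \<phi> \<Gamma>) \<chi> \<Longrightarrow> derives L (insert \<psi> \<Gamma>) \<chi>
    \<Longrightarrow> derives L \<Gamma> \<chi>"
| AllI: "derives L (shift ` \<Gamma>) \<phi> \<Longrightarrow> derives L \<Gamma> (Forall \<phi>)"
| AllE: "derives L \<Gamma> (Forall \<phi>) \<Longrightarrow> wf_tm L t \<Longrightarrow> derives L \<Gamma> (inst t \<phi>)"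
| ExI: "wf_fm L \<phi> \<Longrightarrow> wf_tm L t \<Longrightarrow> derives L \<Gamma> (inst t \<phi>) \<Longrightarrow> derives L \<Gamma> (Exists \<phi>)"
| ExE: "derives L \<Gamma> (Exists \<phi>) \<Longrightarrow> derives L (insert \<phi> (shift ` \<Gamma>)) (shift \<psi>)
    \<Longrightarrow> derives L \<Gamma> \<psi>"
| EqRefl: "wf_tm L t \<Longrightarrow> derives L \<Gamma> (Equal t t)"
| EqSubst: "wf_fm L \<phi> \<Longrightarrow> derives L \<Gamma> (Equal s t) \<Longrightarrow> derives L \<Gamma> (inst s \<phi>)
    \<Longrightarrow> derives L \<Gamma> (inst t \<phi>)"


section \<open>Relative interpretability\<close>

record ('f, 'p) fo_theory =
  lang :: "('f, 'p) signature"
  axms :: "('f, 'p) fm set"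

definition proves :: "('f, 'p) fo_theory \<Rightarrow> ('f, 'p) fm \<Rightarrow> bool" (infix "\<turnstile>" 50) where
  "T \<turnstile> \<phi> \<longleftrightarrow> derives (lang T) (axms T) \<phi>"

text \<open>A one-dimensional, parameter-free translation of the language with symbols
  \<open>'f\<close>, \<open>'p\<close> into the one with symbols \<open>'g\<close>, \<open>'q\<close>. Identity is translated as identity.
  Free variables: index 0 in \<open>dom_fm\<close>; in \<open>fun_fm f\<close>, index 0 is the value and
  \<open>1, ..., n\<close> are the arguments; in \<open>rel_fm p\<close>, \<open>0, ..., n - 1\<close> are the arguments.\<close>

record ('f, 'p, 'g, 'q) translation =
  dom_fm :: "('g, 'q) fm"
  fun_fm :: "'f \<Rightarrow> ('g, 'q) fm"
  rel_fm :: "'p \<Rightarrow> ('g, 'q) fm"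

definition wf_translation ::
  "('f, 'p) signature \<Rightarrow> ('g, 'q) signature \<Rightarrow> ('f, 'p, 'g, 'q) translation \<Rightarrow> bool" where
  "wf_translation L M J \<longleftrightarrow>
     wf_fm M (dom_fm J) \<and> fv_fm (dom_fm J) \<subseteq> {0} \<and>
     (\<forall>f. wf_fm M (fun_fm J f) \<and> fv_fm (fun_fm J f) \<subseteq> {0..fun_arity L f}) \<and>
     (\<forall>p. wf_fm M (rel_fm J p) \<and> fv_fm (rel_fm J p) \<subseteq> {0..<rel_arity L p})"

definition in_dom :: "('f, 'p, 'g, 'q) translation \<Rightarrow> nat \<Rightarrow> ('g, 'q) fm" where
  "in_dom J i = rename (\<lambda>_. i) (dom_fm J)"

text \<open>\<open>with_values J k [g\<^sub>0, ..., g\<^sub>n\<^sub>-\<^sub>1] \<phi>\<close> says that there are \<open>z\<^sub>0, ..., z\<^sub>n\<^sub>-\<^sub>1\<close> in the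
  domain such that each \<open>g\<^sub>i\<close> holds of \<open>z\<^sub>i\<close>, and such that \<open>\<phi>\<close>. In \<open>g\<^sub>i\<close>, index 0 stands
  for \<open>z\<^sub>i\<close> and \<open>Suc v\<close> for the outer variable \<open>v + k\<close>; in \<open>\<phi>\<close>, the indices below \<open>n\<close> stand
  for the \<open>z\<^sub>i\<close> and \<open>v + n\<close> for the outer variable \<open>v\<close>.\<close>

definition with_values ::
  "('f, 'p, 'g, 'q) translation \<Rightarrow> nat \<Rightarrow> ('g, 'q) fm list \<Rightarrow> ('g, 'q) fm \<Rightarrow> ('g, 'q) fm" where
  "with_values J k gs \<phi> = (let n = length gs in
     (Exists ^^ n)
       (And (Conjs (map (\<lambda>i. And (in_dom J i) (rename (case_nat i (\<lambda>v. v + k + n)) (gs ! i))) [0..<n]))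
            \<phi>))"

text \<open>\<open>graph J t\<close> says that the variable 0 is the value of \<open>t\<close>, whose variables \<open>v\<close> appear
  as \<open>Suc v\<close>.\<close>

fun graph :: "('f, 'p, 'g, 'q) translation \<Rightarrow> 'f tm \<Rightarrow> ('g, 'q) fm" where
  "graph J (Var i) = Equal (Var 0) (Var (Suc i))"
| "graph J (Fn f ts) =
     with_values J 1 (map (graph J) ts) (rename (case_nat (length ts) (\<lambda>i. i)) (fun_fm J f))"

primrec translate :: "('f, 'p, 'g, 'q) translation \<Rightarrow> ('f, 'p) fm \<Rightarrow> ('g, 'q) fm" where
  "translate J Falsum = Falsum"
| "translate J (Equal s t) = with_values J 0 [graph J s, graph J t] (Equal (Var 0) (Var 1))"
| "translate J (Rel p ts) = with_values J 0 (map (graph J) ts) (rel_fm J p)"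
| "translate J (Imp \<phi> \<psi>) = Imp (translate J \<phi>) (translate J \<psi>)"
| "translate J (And \<phi> \<psi>) = And (translate J \<phi>) (translate J \<psi>)"
| "translate J (Or \<phi> \<psi>) = Or (translate J \<phi>) (translate J \<psi>)"
| "translate J (Forall \<phi>) = Forall (Imp (in_dom J 0) (translate J \<phi>))"
| "translate J (Exists \<phi>) = Exists (And (in_dom J 0) (translate J \<phi>))"

definition Exists1 :: "('f, 'p) fm \<Rightarrow> ('f, 'p) fm" where
  "Exists1 \<phi> = Exists (And \<phi>
     (Forall (Imp (rename (case_nat 0 (\<lambda>i. Suc (Suc i))) \<phi>) (Equal (Var 0) (Var 1)))))"

text \<open>\<open>fun_total J f n\<close>: for all \<open>n\<close>-tuples in the domain, exactly one element of the domain
  is a value of \<open>f\<close> according to \<open>J\<close>.\<close>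

definition fun_total :: "('f, 'p, 'g, 'q) translation \<Rightarrow> 'f \<Rightarrow> nat \<Rightarrow> ('g, 'q) fm" where
  "fun_total J f n = (Forall ^^ n)
     (Imp (Conjs (map (in_dom J) [0..<n])) (Exists1 (And (in_dom J 0) (fun_fm J f))))"

definition interpretation_of ::
  "('f, 'p, 'g, 'q) translation \<Rightarrow> ('f, 'p) fo_theory \<Rightarrow> ('g, 'q) fo_theory \<Rightarrow> bool" where
  "interpretation_of J T S \<longleftrightarrow>
     wf_translation (lang T) (lang S) J \<and>
     S \<turnstile> Exists (dom_fm J) \<and>
     (\<forall>f. S \<turnstile> fun_total J f (fun_arity (lang T) f)) \<and>
     (\<forall>\<phi> \<in> axms T. S \<turnstile> translate J \<phi>)"

definition interpretable :: "('f, 'p) fo_theory \<Rightarrow> ('g, 'q) fo_theory \<Rightarrow> bool"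
  (infix "\<le>\<^sub>I" 50) where
  "T \<le>\<^sub>I S \<longleftrightarrow> (\<exists>J. interpretation_of J T S)"


section \<open>The theories \<open>VW\<^sub>0\<close> and \<open>VWDI\<close>\<close>

datatype letter = L1 | L2

type_synonym word = "letter list"

definition letters :: "letter list" where
  "letters = [L1, L2]"

text \<open>In the next three definitions, \<open>R x y\<close> is the atomic formula \<open>x R y\<close>.\<close>

definition Strict :: "('f tm \<Rightarrow> 'f tm \<Rightarrow> ('f, 'p) fm) \<Rightarrow> 'f tm \<Rightarrow> 'f tm \<Rightarrow> ('f, 'p) fm" where
  "Strict R x y = And (R x y) (Neg (Equal x y))"

definition antisym_ax :: "('f tm \<Rightarrow> 'f tm \<Rightarrow> ('f, 'p) fm) \<Rightarrow> ('f, 'p) fm" where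
  "antisym_ax R = Forall (Forall
     (Imp (And (R (Var 1) (Var 0)) (R (Var 0) (Var 1))) (Equal (Var 1) (Var 0))))"

text \<open>\<open>\<forall>y. y R x \<longleftrightarrow> y R t\<close>, strictly, for \<open>x\<close> the variable 0 and a closed term \<open>t\<close>.\<close>

definition same_below :: "('f tm \<Rightarrow> 'f tm \<Rightarrow> ('f, 'p) fm) \<Rightarrow> 'f tm \<Rightarrow> ('f, 'p) fm" where
  "same_below R t = Forall (Iff (Strict R (Var 0) (Var 1)) (Strict R (Var 0) t))"

datatype vw0_fun = Const0 word
datatype vw0_rel = Init0 | End0

definition c0 :: "word \<Rightarrow> vw0_fun tm" where "c0 s = Fn (Const0 s) []"

definition init0 :: "vw0_fun tm \<Rightarrow> vw0_fun tm \<Rightarrow> (vw0_fun, vw0_rel) fm" where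
  "init0 x y = Rel Init0 [x, y]"

definition end0 :: "vw0_fun tm \<Rightarrow> vw0_fun tm \<Rightarrow> (vw0_fun, vw0_rel) fm" where
  "end0 x y = Rel End0 [x, y]"

definition VW0 :: "(vw0_fun, vw0_rel) fo_theory" where
  "VW0 = \<lparr>
     lang = \<lparr> fun_arity = (\<lambda>_. 0), rel_arity = (\<lambda>_. 2) \<rparr>,
     axms =
       {Neg (Equal (c0 s) (c0 t)) | s t. s \<noteq> t}
       \<union> {Forall (Iff (init0 (Var 0) (c0 t))
                    (Disjs (map (\<lambda>s. Equal (Var 0) (c0 s)) (prefixes t)))) | t. True}
       \<union> {Forall (Iff (end0 (Var 0) (c0 t))
                    (Disjs (map (\<lambda>s. Equal (Var 0) (c0 s)) (suffixes t)))) | t. True}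
       \<union> {Forall (Imp (same_below init0 (c0 t))
                    (Conjs (map (\<lambda>d. Imp (And (end0 (c0 [d]) (Var 0)) (end0 (c0 [d]) (c0 t)))
                                       (Equal (Var 0) (c0 t))) letters))) | t. True}
       \<union> {Forall (Imp (same_below end0 (c0 t))
                    (Conjs (map (\<lambda>d. Imp (And (init0 (c0 [d]) (Var 0)) (init0 (c0 [d]) (c0 t)))
                                       (Equal (Var 0) (c0 t))) letters))) | t. True}
       \<union> {antisym_ax init0} \<rparr>"

datatype vwdi_fun = ConstI word | Inv
datatype vwdi_rel = InitI

definition cI :: "word \<Rightarrow> vwdi_fun tm" where "cI s = Fn (ConstI s) []"

definition invI :: "vwdi_fun tm \<Rightarrow> vwdi_fun tm" where "invI x = Fn Inv [x]"

definition initI :: "vwdi_fun tm \<Rightarrow> vwdi_fun tm \<Rightarrow> (vwdi_fun, vwdi_rel) fm" where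
  "initI x y = Rel InitI [x, y]"

definition VWDI :: "(vwdi_fun, vwdi_rel) fo_theory" where
  "VWDI = \<lparr>
     lang = \<lparr> fun_arity = case_vwdi_fun (\<lambda>_. 0) 1, rel_arity = (\<lambda>_. 2) \<rparr>,
     axms =
       {Neg (Equal (cI s) (cI t)) | s t. s \<noteq> t}
       \<union> {Equal (invI (cI s)) (cI (rev s)) | s. True}
       \<union> {Forall (Iff (initI (Var 0) (cI t))
                    (Disjs (map (\<lambda>s. Equal (Var 0) (cI s)) (prefixes t)))) | t. True}
       \<union> {Forall (Equal (invI (invI (Var 0))) (Var 0))}
       \<union> {Forall (Imp (same_below initI (cI t))
                    (Conjs (map (\<lambda>d. Imp (And (initI (cI [d]) (invI (Var 0)))
                                            (initI (cI [d]) (invI (cI t))))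
                                       (Equal (Var 0) (cI t))) letters))) | t. True}
       \<union> {antisym_ax initI} \<rparr>"

end

theory Submission
  imports Defs
begin

text \<open>Keep all objects, the constants and \<open>\<sqsubseteq>\<close>, and read \<open>x \<sqsupseteq> y\<close> as \<open>f x \<sqsubseteq> f y\<close>. The axioms of
  \<open>VW\<^sub>0\<close> on initial segments are then axioms of \<open>VWDI\<close> up to \<open>f d = d\<close> for a single letter \<open>d\<close>.
  The axioms on end segments of \<open>t\<close> come from those of \<open>VWDI\<close> for the reversal of \<open>t\<close>,
  instantiated at \<open>f x\<close>, because \<open>f\<close> is an involution. The derivations replace equal terms and
  equivalent formulas throughout, so that the translation, which names the value of each term
  by a quantifier, can first be exchanged for a symbol-by-symbol replacement.\<close>

section \<open>Substitution\<close>

lemma subst_tm_comp: "subst_tm \<sigma> (subst_tm \<tau> t) = subst_tm (\<lambda>i. subst_tm \<sigma> (\<tau> i)) t"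
  by (induction t) auto

lemma subst_tm_Var [simp]: "subst_tm Var t = t"
  by (induction t) (auto intro: map_idI)

lemma up_0 [simp]: "up \<sigma> 0 = Var 0"
  and up_Suc [simp]: "up \<sigma> (Suc i) = subst_tm (\<lambda>j. Var (Suc j)) (\<sigma> i)"
  by (simp_all add: up_def)

text \<open>Lifting under a binder commutes with composition; this is the quantifier case of
  \<open>subst_fm_comp\<close>.\<close>

lemma up_comp: "(\<lambda>i. subst_tm (up \<sigma>) (up \<tau> i)) = up (\<lambda>i. subst_tm \<sigma> (\<tau> i))"
proof
  show "subst_tm (up \<sigma>) (up \<tau> i) = up (\<lambda>i. subst_tm \<sigma> (\<tau> i)) i" for i
    by (cases i) (auto simp: subst_tm_comp)
qed

lemma up_Var [simp]: "up Var = Var"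
proof
  show "up Var i = Var i" for i by (cases i) auto
qed

lemma subst_fm_comp: "subst_fm \<sigma> (subst_fm \<tau> \<phi>) = subst_fm (\<lambda>i. subst_tm \<sigma> (\<tau> i)) \<phi>"
  by (induction \<phi> arbitrary: \<sigma> \<tau>) (auto simp: subst_tm_comp up_comp)

lemma subst_fm_Var [simp]: "subst_fm Var \<phi> = \<phi>"
  by (induction \<phi>) (auto intro: map_idI)

lemma case_nat_up_Suc: "subst_tm (case_nat (Var 0) Var) (up (\<lambda>i. Var (Suc i)) i) = Var i"
  by (cases i) auto

lemma inst_up_Suc [simp]: "inst (Var 0) (subst_fm (up (\<lambda>i. Var (Suc i))) \<phi>) = \<phi>"
  by (simp add: inst_def subst_fm_comp case_nat_up_Suc)

text \<open>The inner term is shifted, so the outer instantiation returns it to \<open>s\<close>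
  without putting \<open>t\<close> into it. Removing two nested quantifiers one after the other
  therefore amounts to one simultaneous substitution.\<close>

lemma inst_inst_shift:
  "inst t (inst (subst_tm (\<lambda>i. Var (Suc i)) s) \<phi>) = subst_fm (case_nat s (case_nat t Var)) \<phi>"
proof -
  have "(\<lambda>i. subst_tm (case_nat t Var) (case_nat (subst_tm (\<lambda>i. Var (Suc i)) s) Var i))
      = case_nat s (case_nat t Var)"
    by (rule ext) (auto simp: subst_tm_comp split: nat.split)
  then show ?thesis by (simp add: inst_def subst_fm_comp)
qed

lemma subst_fm_Conjs: "subst_fm \<sigma> (Conjs \<phi>s) = Conjs (map (subst_fm \<sigma>) \<phi>s)"
  by (induction \<phi>s) (auto simp: Conjs_def)

lemma subst_fm_Disjs: "subst_fm \<sigma> (Disjs \<phi>s) = Disjs (map (subst_fm \<sigma>) \<phi>s)"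
  by (induction \<phi>s) (auto simp: Disjs_def)

section \<open>Well-formedness under substitution\<close>

lemma wf_subst_tm: "wf_tm L t \<Longrightarrow> (\<And>i. wf_tm L (\<sigma> i)) \<Longrightarrow> wf_tm L (subst_tm \<sigma> t)"
  by (induction t) (auto simp: list_all_iff)

lemma wf_rename_tm [simp]: "wf_tm L (subst_tm (\<lambda>i. Var (\<rho> i)) t) = wf_tm L t"
  by (induction t) (auto simp: list_all_iff)

lemma wf_up: "(\<And>i. wf_tm L (\<sigma> i)) \<Longrightarrow> wf_tm L (up \<sigma> i)"
  by (cases i) auto

lemma wf_subst_fm: "wf_fm L \<phi> \<Longrightarrow> (\<And>i. wf_tm L (\<sigma> i)) \<Longrightarrow> wf_fm L (subst_fm \<sigma> \<phi>)"
  by (induction \<phi> arbitrary: \<sigma>) (auto simp: list_all_iff wf_subst_tm wf_up)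

lemma wf_inst: "wf_fm L \<phi> \<Longrightarrow> wf_tm L t \<Longrightarrow> wf_fm L (inst t \<phi>)"
  unfolding inst_def by (rule wf_subst_fm) (auto split: nat.split)

text \<open>A renaming remains a renaming under a binder, so the induction for
  \<open>wf_rename\<close> can keep \<open>\<rho>\<close> arbitrary.\<close>

lemma up_rename: "up (\<lambda>i. Var (\<rho> i)) = (\<lambda>i. Var (case_nat 0 (\<lambda>i. Suc (\<rho> i)) i))"
  by (rule ext) (simp add: up_def split: nat.split)

lemma wf_rename [simp]: "wf_fm L (rename \<rho> \<phi>) = wf_fm L \<phi>"
  unfolding rename_def by (induction \<phi> arbitrary: \<rho>) (auto simp: list_all_iff up_rename)

lemma wf_Conjs [simp]: "wf_fm L (Conjs \<phi>s) \<longleftrightarrow> (\<forall>\<phi>\<in>set \<phi>s. wf_fm L \<phi>)"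
  by (induction \<phi>s) (auto simp: Conjs_def)

lemma wf_Disjs [simp]: "wf_fm L (Disjs \<phi>s) \<longleftrightarrow> (\<forall>\<phi>\<in>set \<phi>s. wf_fm L \<phi>)"
  by (induction \<phi>s) (auto simp: Disjs_def)


section \<open>Derived rules\<close>

lemma derives_wf: "derives L \<Gamma> \<phi> \<Longrightarrow> wf_fm L \<phi>"
  by (induction rule: derives.induct) (auto simp: wf_inst)

text \<open>Rules that change the context do so by \<open>insert\<close> or by the image under
  \<open>shift\<close>, and both are monotone in the context.\<close>

lemma derives_mono: "derives L \<Gamma> \<phi> \<Longrightarrow> \<Gamma> \<subseteq> \<Delta> \<Longrightarrow> derives L \<Delta> \<phi>"
proof (induction arbitrary: \<Delta> rule: derives.induct)
  case (Classical \<phi> \<Gamma>)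
  then show ?case by (meson derives.Classical insert_mono)
next
  case (ImpI \<phi> \<Gamma> \<psi>)
  then show ?case by (meson derives.ImpI insert_mono)
next
  case (OrE \<Gamma> \<phi> \<psi> \<chi>)
  then show ?case by (meson derives.OrE insert_mono)
next
  case (AllI \<Gamma> \<phi>)
  then show ?case by (meson derives.AllI image_mono)
next
  case (ExE \<Gamma> \<phi> \<psi>)
  then show ?case by (meson derives.ExE insert_mono image_mono)
next
  case (Assm \<phi> \<Gamma>)
  then show ?case by (auto intro: derives.Assm)
next
  case (OrI1 \<psi> \<Gamma> \<phi>)
  then show ?case by (auto intro: derives.OrI1)
next
  case (OrI2 \<phi> \<Gamma> \<psi>)
  then show ?case by (auto intro: derives.OrI2)
next
  case (AllE \<Gamma> \<phi> t)
  then show ?case by (auto intro: derives.AllE)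
next
  case (ExI \<phi> t \<Gamma>)
  then show ?case by (auto intro: derives.ExI)
next
  case (EqRefl t \<Gamma>)
  then show ?case by (auto intro: derives.EqRefl)
next
  case (EqSubst \<phi> \<Gamma> s t)
  from EqSubst.hyps(1) EqSubst.IH(1,2)[OF EqSubst.prems] show ?case by (rule derives.EqSubst)
next
  case (ImpE \<Gamma> \<phi> \<psi>)
  from ImpE.IH(1,2)[OF ImpE.prems] show ?case by (rule derives.ImpE)
next
  case (AndI \<Gamma> \<phi> \<psi>)
  from AndI.IH(1,2)[OF AndI.prems] show ?case by (rule derives.AndI)
next
  case (AndE1 \<Gamma> \<phi> \<psi>)
  from AndE1.IH[OF AndE1.prems] show ?case by (rule derives.AndE1)
next
  case (AndE2 \<Gamma> \<phi> \<psi>)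
  from AndE2.IH[OF AndE2.prems] show ?case by (rule derives.AndE2)
qed

lemma derives_insert: "derives L \<Gamma> \<phi> \<Longrightarrow> derives L (insert \<psi> \<Gamma>) \<phi>"
  by (erule derives_mono) auto

lemma derives_True: "derives L \<Gamma> (Neg Falsum)"
  by (rule ImpI) (auto intro: Assm)

text \<open>For use in a shifted context: there \<open>Forall \<phi>\<close> has become the
  displayed formula, and its instance at the eigenvariable 0 is \<open>\<phi>\<close> again.\<close>

lemma AllE_Var0: "derives L \<Gamma> (Forall (subst_fm (up (\<lambda>i. Var (Suc i))) \<phi>)) \<Longrightarrow> derives L \<Gamma> \<phi>"
  using AllE[of L \<Gamma> _ "Var 0"] by fastforce

lemma ExI_Var0:
  "derives L \<Gamma> \<phi> \<Longrightarrow> derives L \<Gamma> (Exists (subst_fm (up (\<lambda>i. Var (Suc i))) \<phi>))"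
  using derives_wf[of L \<Gamma> \<phi>]
  by (intro ExI[where t = "Var 0"]) (auto intro!: wf_subst_fm wf_up)

section \<open>Replacement of equivalent formulas\<close>

lemma IffI:
  "wf_fm L \<phi> \<Longrightarrow> wf_fm L \<psi> \<Longrightarrow> derives L (insert \<phi> \<Gamma>) \<psi> \<Longrightarrow> derives L (insert \<psi> \<Gamma>) \<phi>
    \<Longrightarrow> derives L \<Gamma> (Iff \<phi> \<psi>)"
  by (intro AndI ImpI)

lemma Iff_mp: "derives L \<Gamma> (Iff \<phi> \<psi>) \<Longrightarrow> derives L \<Gamma> \<phi> \<Longrightarrow> derives L \<Gamma> \<psi>"
  by (rule ImpE[OF AndE1])

lemma Iff_sym: "derives L \<Gamma> (Iff \<phi> \<psi>) \<Longrightarrow> derives L \<Gamma> (Iff \<psi> \<phi>)"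
  by (rule AndI[OF AndE2 AndE1])

lemma Iff_mp2: "derives L \<Gamma> (Iff \<phi> \<psi>) \<Longrightarrow> derives L \<Gamma> \<psi> \<Longrightarrow> derives L \<Gamma> \<phi>"
  by (rule Iff_mp[OF Iff_sym])

lemma Iff_wf: "derives L \<Gamma> (Iff \<phi> \<psi>) \<Longrightarrow> wf_fm L \<phi> \<and> wf_fm L \<psi>"
  by (drule derives_wf) auto

lemma Iff_refl: "wf_fm L \<phi> \<Longrightarrow> derives L \<Gamma> (Iff \<phi> \<phi>)"
  by (intro IffI Assm) auto

lemma Iff_trans:
  assumes "derives L \<Gamma> (Iff \<phi> \<psi>)" "derives L \<Gamma> (Iff \<psi> \<chi>)"
  shows "derives L \<Gamma> (Iff \<phi> \<chi>)"
proof -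
  note wf = Iff_wf[OF assms(1)] Iff_wf[OF assms(2)]
  note i = derives_insert[OF assms(1)] derives_insert[OF assms(2)]
  show ?thesis
    by (rule IffI[OF _ _ Iff_mp[OF i(2) Iff_mp[OF i(1) Assm]] Iff_mp2[OF i(1) Iff_mp2[OF i(2) Assm]]])
      (use wf in auto)
qed

text \<open>One half of the congruence rule that follows; the other half is the same statement for
  the symmetric equivalences. The remaining connectives and the quantifiers are treated in this way
  too.\<close>

lemma Imp_mono:
  assumes "derives L \<Gamma> (Iff \<phi> \<phi>')" "derives L \<Gamma> (Iff \<psi> \<psi>')"
  shows "derives L (insert (Imp \<phi> \<psi>) \<Gamma>) (Imp \<phi>' \<psi>')"
proof -
  note wf = Iff_wf[OF assms(1)] Iff_wf[OF assms(2)]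
  let ?\<Gamma> = "insert \<phi>' (insert (Imp \<phi> \<psi>) \<Gamma>)"
  have i: "derives L ?\<Gamma> (Iff \<phi> \<phi>')" "derives L ?\<Gamma> (Iff \<psi> \<psi>')"
    by (intro derives_insert assms)+
  have "derives L ?\<Gamma> \<phi>" by (rule Iff_mp2[OF i(1)]) (use wf in \<open>auto intro: Assm\<close>)
  then have "derives L ?\<Gamma> \<psi>" by (rule ImpE[rotated]) (use wf in \<open>auto intro: Assm\<close>)
  then show ?thesis using wf Iff_mp[OF i(2)] by (simp add: ImpI)
qed

lemma Iff_Imp:
  assumes "derives L \<Gamma> (Iff \<phi> \<phi>')" "derives L \<Gamma> (Iff \<psi> \<psi>')"
  shows "derives L \<Gamma> (Iff (Imp \<phi> \<psi>) (Imp \<phi>' \<psi>'))"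
  using assms[THEN Iff_wf] Imp_mono[OF assms] Imp_mono[OF assms[THEN Iff_sym]]
  by (intro IffI) auto

lemma And_mono:
  assumes "derives L \<Gamma> (Iff \<phi> \<phi>')" "derives L \<Gamma> (Iff \<psi> \<psi>')"
  shows "derives L (insert (And \<phi> \<psi>) \<Gamma>) (And \<phi>' \<psi>')"
proof -
  note wf = Iff_wf[OF assms(1)] Iff_wf[OF assms(2)]
  have a: "derives L (insert (And \<phi> \<psi>) \<Gamma>) (And \<phi> \<psi>)" using wf by (intro Assm) auto
  show ?thesis
    by (intro AndI Iff_mp[OF derives_insert[OF assms(1)]] Iff_mp[OF derives_insert[OF assms(2)]]
        AndE1[OF a] AndE2[OF a])
qed

lemma Iff_And:
  assumes "derives L \<Gamma> (Iff \<phi> \<phi>')" "derives L \<Gamma> (Iff \<psi> \<psi>')"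
  shows "derives L \<Gamma> (Iff (And \<phi> \<psi>) (And \<phi>' \<psi>'))"
  using assms[THEN Iff_wf] And_mono[OF assms] And_mono[OF assms[THEN Iff_sym]]
  by (intro IffI) auto

lemma Or_mono:
  assumes "derives L \<Gamma> (Iff \<phi> \<phi>')" "derives L \<Gamma> (Iff \<psi> \<psi>')"
  shows "derives L (insert (Or \<phi> \<psi>) \<Gamma>) (Or \<phi>' \<psi>')"
proof -
  note wf = Iff_wf[OF assms(1)] Iff_wf[OF assms(2)]
  show ?thesis
  proof (rule OrE)
    show "derives L (insert (Or \<phi> \<psi>) \<Gamma>) (Or \<phi> \<psi>)" using wf by (intro Assm) auto
    show "derives L (insert \<phi> (insert (Or \<phi> \<psi>) \<Gamma>)) (Or \<phi>' \<psi>')"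
      by (rule OrI1, use wf in simp, rule Iff_mp[OF derives_mono[OF assms(1)]])
        (use wf in \<open>auto intro: Assm\<close>)
    show "derives L (insert \<psi> (insert (Or \<phi> \<psi>) \<Gamma>)) (Or \<phi>' \<psi>')"
      by (rule OrI2, use wf in simp, rule Iff_mp[OF derives_mono[OF assms(2)]])
        (use wf in \<open>auto intro: Assm\<close>)
  qed
qed

lemma Iff_Or:
  assumes "derives L \<Gamma> (Iff \<phi> \<phi>')" "derives L \<Gamma> (Iff \<psi> \<psi>')"
  shows "derives L \<Gamma> (Iff (Or \<phi> \<psi>) (Or \<phi>' \<psi>'))"
  using assms[THEN Iff_wf] Or_mono[OF assms] Or_mono[OF assms[THEN Iff_sym]]
  by (intro IffI) auto

lemma Iff_Iff:
  assumes "derives L \<Gamma> (Iff \<phi> \<phi>')" "derives L \<Gamma> (Iff \<psi> \<psi>')"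
  shows "derives L \<Gamma> (Iff (Iff \<phi> \<psi>) (Iff \<phi>' \<psi>'))"
  using assms by (intro Iff_And Iff_Imp)

lemma Iff_Neg: "derives L \<Gamma> (Iff \<phi> \<phi>') \<Longrightarrow> derives L \<Gamma> (Iff (Neg \<phi>) (Neg \<phi>'))"
  by (intro Iff_Imp Iff_refl) auto

lemma Iff_Conjs:
  "(\<And>x. x \<in> set xs \<Longrightarrow> derives L \<Gamma> (Iff (A x) (B x)))
    \<Longrightarrow> derives L \<Gamma> (Iff (Conjs (map A xs)) (Conjs (map B xs)))"
  by (induction xs) (auto simp: Conjs_def intro!: Iff_And Iff_refl)

lemma Iff_Disjs:
  "(\<And>x. x \<in> set xs \<Longrightarrow> derives L \<Gamma> (Iff (A x) (B x)))
    \<Longrightarrow> derives L \<Gamma> (Iff (Disjs (map A xs)) (Disjs (map B xs)))"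
  by (induction xs) (auto simp: Disjs_def intro!: Iff_Or Iff_refl)

text \<open>The equivalence of the bodies is assumed in the shifted context, where index 0 is fresh
  and can serve as the eigenvariable.\<close>

lemma Forall_mono:
  assumes "derives L (shift ` \<Gamma>) (Iff \<phi> \<psi>)"
  shows "derives L (insert (Forall \<phi>) \<Gamma>) (Forall \<psi>)"
proof (rule AllI)
  let ?\<Gamma> = "shift ` insert (Forall \<phi>) \<Gamma>"
  have "derives L ?\<Gamma> (shift (Forall \<phi>))"
    using Iff_wf[OF assms] by (intro Assm) auto
  then have "derives L ?\<Gamma> \<phi>" by (simp add: rename_def AllE_Var0)
  then show "derives L ?\<Gamma> \<psi>" by (rule Iff_mp[OF derives_mono[OF assms], rotated]) auto
qed

lemma Iff_Forall:
  assumes "derives L (shift ` \<Gamma>) (Iff \<phi> \<psi>)"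
  shows "derives L \<Gamma> (Iff (Forall \<phi>) (Forall \<psi>))"
  using Iff_wf[OF assms] Forall_mono[OF assms] Forall_mono[OF assms[THEN Iff_sym]]
  by (intro IffI) auto

lemma Exists_mono:
  assumes "derives L (shift ` \<Gamma>) (Iff \<phi> \<psi>)"
  shows "derives L (insert (Exists \<phi>) \<Gamma>) (Exists \<psi>)"
proof (rule ExE)
  note wf = Iff_wf[OF assms]
  show "derives L (insert (Exists \<phi>) \<Gamma>) (Exists \<phi>)" using wf by (intro Assm) auto
  let ?\<Gamma> = "insert \<phi> (shift ` insert (Exists \<phi>) \<Gamma>)"
  have "derives L ?\<Gamma> \<phi>" using wf by (intro Assm) auto
  then have "derives L ?\<Gamma> \<psi>" by (rule Iff_mp[OF derives_mono[OF assms], rotated]) auto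
  then show "derives L ?\<Gamma> (shift (Exists \<psi>))" by (simp add: rename_def ExI_Var0)
qed

lemma Iff_Exists:
  assumes "derives L (shift ` \<Gamma>) (Iff \<phi> \<psi>)"
  shows "derives L \<Gamma> (Iff (Exists \<phi>) (Exists \<psi>))"
  using Iff_wf[OF assms] Exists_mono[OF assms] Exists_mono[OF assms[THEN Iff_sym]]
  by (intro IffI) auto

lemma Iff_And_True: "wf_fm L \<phi> \<Longrightarrow> derives L \<Gamma> (Iff (And (Neg Falsum) \<phi>) \<phi>)"
  by (rule IffI[OF _ _ AndE2[OF Assm[OF insertI1]] AndI[OF derives_True Assm]]) auto

lemma Iff_And_True2: "wf_fm L \<phi> \<Longrightarrow> derives L \<Gamma> (Iff (And \<phi> (Neg Falsum)) \<phi>)"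
  by (rule IffI[OF _ _ AndE1[OF Assm[OF insertI1]] AndI[OF Assm derives_True]]) auto

lemma Iff_And_assoc:
  assumes "wf_fm L \<phi>" "wf_fm L \<psi>" "wf_fm L \<chi>"
  shows "derives L \<Gamma> (Iff (And (And \<phi> \<psi>) \<chi>) (And \<phi> (And \<psi> \<chi>)))" (is "derives L \<Gamma> (Iff ?A ?B)")
proof (rule IffI)
  have a: "derives L (insert ?A \<Gamma>) ?A" and b: "derives L (insert ?B \<Gamma>) ?B"
    using assms by (auto intro: Assm)
  show "derives L (insert ?A \<Gamma>) ?B"
    by (intro AndI AndE2[OF a] AndE1[OF AndE1[OF a]] AndE2[OF AndE1[OF a]])
  show "derives L (insert ?B \<Gamma>) ?A"
    by (intro AndI AndE1[OF b] AndE1[OF AndE2[OF b]] AndE2[OF AndE2[OF b]])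
qed (use assms in auto)

section \<open>Equality and replacement of equal terms\<close>

lemma Eq_wf: "derives L \<Gamma> (Equal s t) \<Longrightarrow> wf_tm L s \<and> wf_tm L t"
  by (drule derives_wf) auto

lemma inst_tm_shift [simp]:
  "subst_tm (case_nat t Var) (subst_tm (\<lambda>i. Var (Suc i)) s) = s"
  by (simp add: subst_tm_comp)

text \<open>Replacement acts on the template \<open>x = s\<close>, which holds at \<open>s\<close>
  by reflexivity. The shift protects the fixed occurrence of \<open>s\<close> from the
  instantiation.\<close>

lemma Eq_sym:
  assumes "derives L \<Gamma> (Equal s t)"
  shows "derives L \<Gamma> (Equal t s)"
  using EqSubst[of L "Equal (Var 0) (subst_tm (\<lambda>i. Var (Suc i)) s)", OF _ assms]
    Eq_wf[OF assms] EqRefl[of L s \<Gamma>]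
  by (simp add: inst_def)

lemma Eq_trans:
  assumes "derives L \<Gamma> (Equal s t)" "derives L \<Gamma> (Equal t u)"
  shows "derives L \<Gamma> (Equal s u)"
  using EqSubst[of L "Equal (subst_tm (\<lambda>i. Var (Suc i)) s) (Var 0)", OF _ assms(2)]
    Eq_wf[OF assms(1)] assms(1)
  by (simp add: inst_def)

lemma Iff_inst:
  assumes "wf_fm L \<phi>" and eq: "derives L \<Gamma> (Equal s t)"
  shows "derives L \<Gamma> (Iff (inst s \<phi>) (inst t \<phi>))"
  using assms Eq_wf[OF eq]
  by (intro IffI[OF _ _ EqSubst[OF _ derives_insert[OF eq] Assm]
        EqSubst[OF _ derives_insert[OF Eq_sym[OF eq]] Assm]])
    (auto intro: wf_inst)

text \<open>One argument changes at a time: \<open>Var 0\<close> marks its place, and the other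
  argument is shifted so that instantiation leaves it intact.\<close>

lemma Iff_Equal:
  assumes "derives L \<Gamma> (Equal s s')" "derives L \<Gamma> (Equal t t')"
  shows "derives L \<Gamma> (Iff (Equal s t) (Equal s' t'))"
  using Iff_inst[of L "Equal (Var 0) (subst_tm (\<lambda>i. Var (Suc i)) t)", OF _ assms(1)]
    Iff_inst[of L "Equal (subst_tm (\<lambda>i. Var (Suc i)) s') (Var 0)", OF _ assms(2)]
    Eq_wf[OF assms(1)] Eq_wf[OF assms(2)]
  by (simp add: inst_def) (rule Iff_trans)

lemma Iff_Rel2:
  assumes "derives L \<Gamma> (Equal s s')" "derives L \<Gamma> (Equal t t')" "rel_arity L p = 2"
  shows "derives L \<Gamma> (Iff (Rel p [s, t]) (Rel p [s', t']))"
  using Iff_inst[of L "Rel p [Var 0, subst_tm (\<lambda>i. Var (Suc i)) t]", OF _ assms(1)]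
    Iff_inst[of L "Rel p [subst_tm (\<lambda>i. Var (Suc i)) s', Var 0]", OF _ assms(2)]
    Eq_wf[OF assms(1)] Eq_wf[OF assms(2)] assms(3)
  by (simp add: inst_def) (rule Iff_trans)

lemma Eq_Fn1:
  assumes "derives L \<Gamma> (Equal s t)" "fun_arity L f = 1"
  shows "derives L \<Gamma> (Equal (Fn f [s]) (Fn f [t]))"
  using EqSubst[of L "Equal (Fn f [subst_tm (\<lambda>i. Var (Suc i)) s]) (Fn f [Var 0])", OF _ assms(1)]
    Eq_wf[OF assms(1)] assms(2) EqRefl[of L "Fn f [s]"]
  by (simp add: inst_def)

text \<open>The one-point rule, by which the quantifiers naming the values of terms are
  eliminated.\<close>

lemma Iff_one_point:
  assumes "wf_fm L \<phi>" "wf_tm L t"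
  shows "derives L \<Gamma>
    (Iff (Exists (And (Equal (Var 0) (subst_tm (\<lambda>i. Var (Suc i)) t)) \<phi>)) (inst t \<phi>))"
    (is "derives L \<Gamma> (Iff (Exists (And ?E \<phi>)) _)")
proof (rule IffI)
  let ?\<Gamma> = "insert (And ?E \<phi>) (shift ` insert (Exists (And ?E \<phi>)) \<Gamma>)"
  have a: "derives L ?\<Gamma> (And ?E \<phi>)" using assms by (intro Assm) auto
  have wf: "wf_fm L (subst_fm (up (\<lambda>i. Var (Suc i))) \<phi>)"
    using assms by (auto intro!: wf_subst_fm wf_up)
  \<comment> \<open>The template lifts all indices but 0. At \<open>Var 0\<close> it is
    \<open>\<phi>\<close>, which the context supplies; at the shifted \<open>t\<close> it is the
    shifted conclusion that \<open>ExE\<close> asks for.\<close>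
  have "inst (subst_tm (\<lambda>i. Var (Suc i)) t) (subst_fm (up (\<lambda>i. Var (Suc i))) \<phi>)
      = shift (inst t \<phi>)"
  proof -
    have "(\<lambda>i. subst_tm (case_nat (subst_tm (\<lambda>i. Var (Suc i)) t) Var) (up (\<lambda>i. Var (Suc i)) i))
        = (\<lambda>i. subst_tm (\<lambda>i. Var (Suc i)) (case_nat t Var i))"
      by (rule ext) (auto simp: up_def split: nat.split)
    then show ?thesis by (simp add: inst_def rename_def subst_fm_comp)
  qed
  then have "derives L ?\<Gamma> (shift (inst t \<phi>))"
    using EqSubst[OF wf AndE1[OF a]] AndE2[OF a] by simp
  then show "derives L (insert (Exists (And ?E \<phi>)) \<Gamma>) (inst t \<phi>)"
    using assms by (auto intro: ExE[OF Assm])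
next
  show "derives L (insert (inst t \<phi>) \<Gamma>) (Exists (And ?E \<phi>))"
  proof (rule ExI[of _ _ t])
    show "derives L (insert (inst t \<phi>) \<Gamma>) (inst t (And ?E \<phi>))"
      using AndI[OF EqRefl[OF assms(2)] Assm[OF insertI1 wf_inst[OF assms]]]
      by (simp add: inst_def)
  qed (use assms in auto)
qed (use assms in \<open>auto intro: wf_inst\<close>)


section \<open>The interpretation\<close>

fun rev_rel :: "vw0_rel \<Rightarrow> vwdi_fun tm \<Rightarrow> vwdi_fun tm \<Rightarrow> (vwdi_fun, vwdi_rel) fm" where
  "rev_rel Init0 x y = initI x y"
| "rev_rel End0 x y = initI (invI x) (invI y)"

definition rev_translation :: "(vw0_fun, vw0_rel, vwdi_fun, vwdi_rel) translation" where
  "rev_translation = \<lparr>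
     dom_fm = Neg Falsum,
     fun_fm = case_vw0_fun (\<lambda>s. Equal (Var 0) (cI s)),
     rel_fm = (\<lambda>p. rev_rel p (Var 0) (Var 1)) \<rparr>"

fun direct_tm :: "vw0_fun tm \<Rightarrow> vwdi_fun tm" where
  "direct_tm (Var i) = Var i"
| "direct_tm (Fn (Const0 s) ts) = cI s"

text \<open>\<open>direct\<close> replaces symbols without naming the values of terms by quantifiers, as
  \<open>translate\<close> does; in \<open>VW0\<close>, relation symbols are binary and function symbols constants.\<close>

primrec direct :: "(vw0_fun, vw0_rel) fm \<Rightarrow> (vwdi_fun, vwdi_rel) fm" where
  "direct Falsum = Falsum"
| "direct (Equal s t) = Equal (direct_tm s) (direct_tm t)"
| "direct (Rel p ts) = rev_rel p (direct_tm (ts ! 0)) (direct_tm (ts ! 1))"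
| "direct (Imp \<phi> \<psi>) = Imp (direct \<phi>) (direct \<psi>)"
| "direct (And \<phi> \<psi>) = And (direct \<phi>) (direct \<psi>)"
| "direct (Or \<phi> \<psi>) = Or (direct \<phi>) (direct \<psi>)"
| "direct (Forall \<phi>) = Forall (direct \<phi>)"
| "direct (Exists \<phi>) = Exists (direct \<phi>)"

lemma direct_Conjs: "direct (Conjs \<phi>s) = Conjs (map direct \<phi>s)"
  by (induction \<phi>s) (auto simp: Conjs_def)

lemma direct_Disjs: "direct (Disjs \<phi>s) = Disjs (map direct \<phi>s)"
  by (induction \<phi>s) (auto simp: Disjs_def)

abbreviation LI :: "(vwdi_fun, vwdi_rel) signature" where
  "LI \<equiv> lang VWDI"

lemma LI_simps [simp]: "fun_arity LI (ConstI s) = 0" "fun_arity LI Inv = 1" "rel_arity LI p = 2"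
  by (simp_all add: VWDI_def)

lemma wf_VWDI [simp]:
  "wf_tm LI (cI s)" "wf_tm LI (invI x) = wf_tm LI x"
  "wf_fm LI (initI x y) \<longleftrightarrow> wf_tm LI x \<and> wf_tm LI y"
  by (simp_all add: cI_def invI_def initI_def)

lemma subst_VWDI [simp]:
  "subst_tm \<sigma> (cI s) = cI s" "subst_tm \<sigma> (invI x) = invI (subst_tm \<sigma> x)"
  "subst_fm \<sigma> (initI x y) = initI (subst_tm \<sigma> x) (subst_tm \<sigma> y)"
  by (simp_all add: cI_def invI_def initI_def)

lemma wf_direct_tm [simp]: "wf_tm LI (direct_tm t)"
  by (cases t rule: direct_tm.cases) auto

lemma wf_rev_rel: "wf_tm LI x \<Longrightarrow> wf_tm LI y \<Longrightarrow> wf_fm LI (rev_rel p x y)"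
  by (cases p) auto

lemma subst_rev_rel: "subst_fm \<sigma> (rev_rel p x y) = rev_rel p (subst_tm \<sigma> x) (subst_tm \<sigma> y)"
  by (cases p) auto

section \<open>Exchanging the translation for symbol replacement\<close>

lemma in_dom_rev: "in_dom rev_translation i = Neg Falsum"
  by (simp add: in_dom_def rev_translation_def rename_def)

text \<open>The graph of a variable is already an equation. The graph of a constant has no
  arguments, so its quantifier prefix is empty and only a trivial conjunct remains. The renaming
  \<open>\<rho>\<close> stands for the displacement of outer variables in
  \<open>with_values\<close>.\<close>

lemma graph_direct:
  assumes "wf_tm (lang VW0) t"
  shows "derives LI \<Gamma> (Iff
    (And (in_dom rev_translation i) (rename (case_nat i \<rho>) (graph rev_translation t)))
    (Equal (Var i) (subst_tm (\<lambda>j. Var (\<rho> j)) (direct_tm t))))"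
proof (cases t rule: direct_tm.cases)
  case (1 j)
  then show ?thesis by (auto simp: in_dom_rev rename_def intro: Iff_And_True)
next
  case (2 s ts)
  with assms have "ts = []" by (simp add: VW0_def)
  with 2 have "rename (case_nat i \<rho>) (graph rev_translation t)
      = And (Neg Falsum) (Equal (Var i) (cI s))"
    by (simp add: with_values_def Conjs_def rename_def rev_translation_def)
  then show ?thesis
    using 2 by (auto simp: in_dom_rev intro!: Iff_trans[OF Iff_And_True] Iff_And_True)
qed

text \<open>This covers both kinds of atomic formula that need it, since identity and the relation
  symbols of \<open>VW0\<close> are all binary. Each quantified value is fixed by an equation, so
  the one-point rule applies twice.\<close>

lemma with_values_direct:
  assumes "wf_tm (lang VW0) s" "wf_tm (lang VW0) t" "wf_fm LI \<phi>"
  shows "derives LI \<Gamma> (Iff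
    (with_values rev_translation 0 [graph rev_translation s, graph rev_translation t] \<phi>)
    (subst_fm (case_nat (direct_tm s) (case_nat (direct_tm t) Var)) \<phi>))"
proof -
  let ?S = "subst_tm (\<lambda>j. Var (Suc j))"
  let ?g = "\<lambda>i t. And (in_dom rev_translation i)
    (rename (case_nat i (\<lambda>v. Suc (Suc v))) (graph rev_translation t))"
  let ?s = "?S (direct_tm s)" and ?t = "?S (direct_tm t)"
  have "with_values rev_translation 0 [graph rev_translation s, graph rev_translation t] \<phi>
      = Exists (Exists (And (And (?g 0 s) (And (?g 1 t) (Neg Falsum))) \<phi>))"
    by (simp add: with_values_def Conjs_def upt_rec numeral_2_eq_2)
  \<comment> \<open>The context is kept arbitrary here and below, because passing under
    \<open>Exists\<close> shifts it. The double shift reflects the two quantified values.\<close>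
  moreover have g: "derives LI \<Gamma> (Iff (?g i t) (Equal (Var i) (?S (?S (direct_tm t)))))"
    if "wf_tm (lang VW0) t" for \<Gamma> i t
    using graph_direct[OF that, of \<Gamma> i "\<lambda>v. Suc (Suc v)"] by (simp add: subst_tm_comp)
  \<comment> \<open>Regrouping isolates the equation for index 0, the variable of the inner
    quantifier.\<close>
  have "derives LI \<Gamma> (Iff (And (And (?g 0 s) (And (?g 1 t) (Neg Falsum))) \<phi>)
      (And (Equal (Var 0) (?S ?s)) (And (Equal (Var 1) (?S ?t)) \<phi>)))" for \<Gamma>
  proof (rule Iff_trans)
    show "derives LI \<Gamma> (Iff (And (And (?g 0 s) (And (?g 1 t) (Neg Falsum))) \<phi>)
      (And (And (Equal (Var 0) (?S ?s)) (Equal (Var 1) (?S ?t))) \<phi>))"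
      using Iff_wf[OF g] assms by (intro Iff_And g Iff_trans[OF Iff_And_True2 g] Iff_refl) auto
  qed (use assms in \<open>auto intro: Iff_And_assoc\<close>)
  \<comment> \<open>Eliminating the inner quantifier inserts the value of \<open>s\<close> and
    lowers index 1 to 0, so the equation for \<open>t\<close> is ready for the outer
    quantifier.\<close>
  then have "derives LI \<Gamma> (Iff (Exists (And (And (?g 0 s) (And (?g 1 t) (Neg Falsum))) \<phi>))
      (And (Equal (Var 0) ?t) (inst ?s \<phi>)))" for \<Gamma>
    using Iff_trans[OF Iff_Exists Iff_one_point[of LI "And (Equal (Var 1) (?S ?t)) \<phi>" ?s]] assms
    by (simp add: inst_def)
  then have "derives LI \<Gamma> (Iff (Exists (Exists (And (And (?g 0 s) (And (?g 1 t) (Neg Falsum))) \<phi>)))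
      (inst (direct_tm t) (inst ?s \<phi>)))"
    using Iff_trans[OF Iff_Exists Iff_one_point[of LI "inst ?s \<phi>" "direct_tm t"]] assms
    by (simp add: wf_inst)
  ultimately show ?thesis by (simp add: inst_inst_shift)
qed

text \<open>Atomic formulas are the case just treated, and relativization disappears because the
  domain formula is \<open>Neg Falsum\<close>. The context is arbitrary since the quantifier cases
  use the induction hypothesis in a shifted one.\<close>

lemma translate_direct:
  "wf_fm (lang VW0) \<phi> \<Longrightarrow> derives LI \<Gamma> (Iff (translate rev_translation \<phi>) (direct \<phi>))"
proof (induction \<phi> arbitrary: \<Gamma>)
  case (Equal s t)
  then show ?case using with_values_direct[of s t "Equal (Var 0) (Var 1)" \<Gamma>] by simp
next
  case (Rel p ts)
  then obtain s t where "ts = [s, t]" "wf_tm (lang VW0) s" "wf_tm (lang VW0) t"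
    by (auto simp: VW0_def length_Suc_conv numeral_2_eq_2)
  then show ?case
    using with_values_direct[of s t "rev_rel p (Var 0) (Var 1)" \<Gamma>]
    by (simp add: subst_rev_rel wf_rev_rel rev_translation_def)
next
  case (Forall \<phi>)
  then have i: "derives LI (shift ` \<Gamma>) (Iff (translate rev_translation \<phi>) (direct \<phi>))" by simp
  have "derives LI \<Delta> (Iff (Imp (Neg Falsum) \<psi>) \<psi>)" if "wf_fm LI \<psi>" for \<Delta> \<psi>
    by (rule IffI[OF _ _ ImpE[OF Assm[OF insertI1] derives_True] ImpI[OF _ Assm]])
      (use that in auto)
  then show ?case
    using Iff_Forall[OF Iff_trans[OF _ i]] Iff_wf[OF i] by (simp add: in_dom_rev)
next
  case (Exists \<phi>)
  then have i: "derives LI (shift ` \<Gamma>) (Iff (translate rev_translation \<phi>) (direct \<phi>))" by simp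
  then show ?case
    using Iff_Exists[OF Iff_trans[OF Iff_And_True i]] Iff_wf[OF i] by (simp add: in_dom_rev)
qed (auto intro: Iff_refl Iff_Imp Iff_And Iff_Or)


section \<open>Deriving the axioms of \<open>VW\<^sub>0\<close>\<close>

text \<open>The axioms are sentences, so generalizing over index 0 is always permitted when they are
  the only assumptions.\<close>

lemma shift_VWDI: "shift ` axms VWDI = axms VWDI"
proof -
  have "shift \<phi> = \<phi>" if "\<phi> \<in> axms VWDI" for \<phi>
    using that by (auto simp: VWDI_def rename_def subst_fm_Disjs subst_fm_Conjs same_below_def
        Strict_def antisym_ax_def comp_def)
  then show ?thesis by auto
qed

abbreviation derivesI :: "(vwdi_fun, vwdi_rel) fm \<Rightarrow> bool" where
  "derivesI \<equiv> derives LI (axms VWDI)"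

abbreviation prefix_ax :: "word \<Rightarrow> (vwdi_fun, vwdi_rel) fm" where
  "prefix_ax t \<equiv> Iff (initI (Var 0) (cI t)) (Disjs (map (\<lambda>s. Equal (Var 0) (cI s)) (prefixes t)))"

abbreviation below_ax :: "word \<Rightarrow> (vwdi_fun, vwdi_rel) fm" where
  "below_ax t \<equiv> Imp (same_below initI (cI t))
     (Conjs (map (\<lambda>d. Imp (And (initI (cI [d]) (invI (Var 0))) (initI (cI [d]) (invI (cI t))))
                        (Equal (Var 0) (cI t))) letters))"

lemma VWDI_axms:
  "s \<noteq> t \<Longrightarrow> Neg (Equal (cI s) (cI t)) \<in> axms VWDI"
  "Equal (invI (cI s)) (cI (rev s)) \<in> axms VWDI"
  "Forall (prefix_ax t) \<in> axms VWDI"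
  "Forall (Equal (invI (invI (Var 0))) (Var 0)) \<in> axms VWDI"
  "Forall (below_ax t) \<in> axms VWDI"
  "antisym_ax initI \<in> axms VWDI"
  by (auto simp: VWDI_def)

lemma wf_same_below [simp]: "wf_fm LI (same_below initI (cI t))"
  by (simp add: same_below_def Strict_def)

lemma VWDI_neq: "s \<noteq> t \<Longrightarrow> derivesI (Neg (Equal (cI s) (cI t)))"
  and VWDI_inv_const: "derivesI (Equal (invI (cI s)) (cI (rev s)))"
  and VWDI_prefix: "derivesI (Forall (prefix_ax t))"
  and VWDI_below: "derivesI (Forall (below_ax t))"
  and VWDI_antisym: "derivesI (antisym_ax initI)"
  by (rule Assm, erule VWDI_axms, simp, (rule Assm, rule VWDI_axms, simp add: antisym_ax_def)+)

lemma VWDI_inv_inv: "wf_tm LI x \<Longrightarrow> derivesI (Equal (invI (invI x)) x)"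
  using AllE[OF Assm[OF VWDI_axms(4)], of LI x] by (simp add: inst_def)

lemma VWDI_AllI: "derivesI \<phi> \<Longrightarrow> derivesI (Forall \<phi>)"
  by (rule AllI) (simp add: shift_VWDI)

lemma Iff_Forall_VWDI: "derivesI (Iff \<phi> \<psi>) \<Longrightarrow> derivesI (Iff (Forall \<phi>) (Forall \<psi>))"
  by (rule Iff_Forall) (simp add: shift_VWDI)

section \<open>Calculating with the involution\<close>

lemma Eq_invI: "derives LI \<Gamma> (Equal s t) \<Longrightarrow> derives LI \<Gamma> (Equal (invI s) (invI t))"
  unfolding invI_def by (rule Eq_Fn1) auto

lemma Iff_initI:
  "derives LI \<Gamma> (Equal s s') \<Longrightarrow> derives LI \<Gamma> (Equal t t')
    \<Longrightarrow> derives LI \<Gamma> (Iff (initI s t) (initI s' t'))"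
  unfolding initI_def by (rule Iff_Rel2) auto

text \<open>Apply \<open>f\<close> to both sides and cancel the double application by
  (VWDI4).\<close>

lemma Iff_invI_swap:
  assumes "wf_tm LI x" "wf_tm LI y"
  shows "derivesI (Iff (Equal (invI x) y) (Equal x (invI y)))"
proof (rule IffI)
  show "derives LI (insert (Equal (invI x) y) (axms VWDI)) (Equal x (invI y))"
    using assms
    by (intro Eq_trans[OF Eq_sym[OF derives_insert[OF VWDI_inv_inv]] Eq_invI[OF Assm]]) auto
  show "derives LI (insert (Equal x (invI y)) (axms VWDI)) (Equal (invI x) y)"
    using assms by (intro Eq_trans[OF Eq_invI[OF Assm] derives_insert[OF VWDI_inv_inv]]) auto
qed (use assms in auto)

lemma Iff_invI_const:
  assumes "wf_tm LI x"
  shows "derivesI (Iff (Equal (invI x) (cI s)) (Equal x (cI (rev s))))"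
  using assms
  by (intro Iff_trans[OF Iff_invI_swap] Iff_Equal EqRefl VWDI_inv_const) auto

text \<open>The end-segment axiom for \<open>t\<close> is the initial-segment axiom for
  \<open>rev t\<close> at \<open>f x\<close>: the prefixes of \<open>rev t\<close> are the reversals
  of the suffixes of \<open>t\<close>, and \<open>f x\<close> equals the reversal of
  \<open>s\<close> exactly when \<open>x\<close> equals \<open>s\<close>.\<close>

lemma VWDI_suffix:
  "derivesI (Iff (initI (invI (Var 0)) (invI (cI t)))
    (Disjs (map (\<lambda>s. Equal (Var 0) (cI s)) (suffixes t))))"
proof (rule Iff_trans)
  show "derivesI (Iff (initI (invI (Var 0)) (invI (cI t))) (initI (invI (Var 0)) (cI (rev t))))"
    by (intro Iff_initI EqRefl VWDI_inv_const) auto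
  have "derivesI (Iff (initI (invI (Var 0)) (cI (rev t)))
      (Disjs (map (\<lambda>s. Equal (invI (Var 0)) (cI (rev s))) (suffixes t))))"
    using AllE[OF VWDI_prefix, of "invI (Var 0)" "rev t"]
    by (simp add: inst_def subst_fm_Disjs comp_def prefixes_rev)
  moreover have "derivesI (Iff (Disjs (map (\<lambda>s. Equal (invI (Var 0)) (cI (rev s))) (suffixes t)))
      (Disjs (map (\<lambda>s. Equal (Var 0) (cI s)) (suffixes t))))"
    using Iff_invI_const[of "Var 0" "rev s" for s] by (intro Iff_Disjs) simp
  ultimately show "derivesI (Iff (initI (invI (Var 0)) (cI (rev t)))
      (Disjs (map (\<lambda>s. Equal (Var 0) (cI s)) (suffixes t))))"
    by (rule Iff_trans)
qed

text \<open>Compared with (VWDI5), \<open>f d\<close> stands in place of \<open>d\<close> for a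
  letter \<open>d\<close>; the two are equal because a one-letter word is its own reversal.\<close>

lemma VWDI_same_below_init:
  "derivesI (Forall (Imp (same_below initI (cI t))
    (Conjs (map (\<lambda>d. Imp (And (initI (invI (cI [d])) (invI (Var 0)))
                            (initI (invI (cI [d])) (invI (cI t))))
                       (Equal (Var 0) (cI t))) letters))))"
proof (rule Iff_mp2[OF Iff_Forall_VWDI VWDI_below])
  have "derivesI (Equal (invI (cI [d])) (cI [d]))" for d
    using VWDI_inv_const[of "[d]"] by simp
  then show "derivesI (Iff (Imp (same_below initI (cI t))
      (Conjs (map (\<lambda>d. Imp (And (initI (invI (cI [d])) (invI (Var 0)))
                              (initI (invI (cI [d])) (invI (cI t))))
                         (Equal (Var 0) (cI t))) letters))) (below_ax t))"
    by (intro Iff_Imp Iff_Conjs Iff_And Iff_initI EqRefl Iff_refl) auto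
qed

text \<open>This is the axiom of \<open>VWDI\<close> for \<open>same_below\<close> at \<open>f x\<close> and the reversal of \<open>t\<close>.\<close>

lemma VWDI_same_below_end:
  "derivesI (Forall (Imp (same_below (\<lambda>x y. initI (invI x) (invI y)) (cI t))
    (Conjs (map (\<lambda>d. Imp (And (initI (cI [d]) (Var 0)) (initI (cI [d]) (cI t)))
                       (Equal (Var 0) (cI t))) letters))))"
    (is "derivesI (Forall (Imp ?S ?C))")
proof (rule VWDI_AllI, rule ImpI)
  \<comment> \<open>\<open>?S'\<close> and \<open>?C'\<close> are the hypothesis and the conclusion
    of the instance of (VWDI5) at \<open>f x\<close> and \<open>rev t\<close>.\<close>
  let ?S' = "Forall (Iff (Strict initI (Var 0) (invI (Var 1))) (Strict initI (Var 0) (cI (rev t))))"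
  let ?C' = "Conjs (map (\<lambda>d. Imp (And (initI (cI [d]) (invI (invI (Var 0))))
                                    (initI (cI [d]) (invI (cI (rev t)))))
                               (Equal (invI (Var 0)) (cI (rev t)))) letters)"
  show wf: "wf_fm LI ?S" by (simp add: same_below_def Strict_def)
  have inv_t: "derivesI (Equal (invI (cI (rev t))) (cI t))"
    using VWDI_inv_const[of "rev t"] by simp
  have imp: "derivesI (Imp ?S' ?C')"
    using AllE[OF VWDI_below, of "invI (Var 0)" "rev t"]
    by (simp add: inst_def subst_fm_Conjs comp_def same_below_def Strict_def)
  have below: "derives LI (insert ?S (axms VWDI)) ?S'"
  proof (rule AllI)
    let ?\<Gamma> = "shift ` insert ?S (axms VWDI)"
    have "derives LI ?\<Gamma> (shift ?S)" using wf by (intro Assm) auto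
    \<comment> \<open>To obtain \<open>?S'\<close> at \<open>y\<close>, the assumption is used at
      \<open>f y\<close>. Inside its quantifier the shifted \<open>x\<close> is
      \<open>Var 2\<close>; after the instantiation \<open>x\<close> is \<open>Var 1\<close> and
      \<open>y\<close> is \<open>Var 0\<close>.\<close>
    then have "derives LI ?\<Gamma> (inst (invI (Var 0)) (Iff
        (And (initI (invI (Var 0)) (invI (Var 2))) (Neg (Equal (Var 0) (Var 2))))
        (And (initI (invI (Var 0)) (invI (cI t))) (Neg (Equal (Var 0) (cI t))))))"
      by (intro AllE) (simp_all add: rename_def same_below_def Strict_def numeral_2_eq_2)
    then have H: "derives LI ?\<Gamma> (Iff
        (And (initI (invI (invI (Var 0))) (invI (Var 1))) (Neg (Equal (invI (Var 0)) (Var 1))))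
        (And (initI (invI (invI (Var 0))) (invI (cI t))) (Neg (Equal (invI (Var 0)) (cI t)))))"
      by (simp add: inst_def numeral_2_eq_2)
    \<comment> \<open>Here \<open>f (f y)\<close> becomes \<open>y\<close>, the equation
      \<open>f y = x\<close> becomes \<open>y = f x\<close>, and \<open>f\<close> of the constant
      for \<open>t\<close> becomes the constant for \<open>rev t\<close>.\<close>
    have "derivesI (Iff (Iff
        (And (initI (invI (invI (Var 0))) (invI (Var 1))) (Neg (Equal (invI (Var 0)) (Var 1))))
        (And (initI (invI (invI (Var 0))) (invI (cI t))) (Neg (Equal (invI (Var 0)) (cI t)))))
        (Iff (Strict initI (Var 0) (invI (Var 1))) (Strict initI (Var 0) (cI (rev t)))))"
      unfolding Strict_def
      by (intro Iff_Iff Iff_And Iff_Neg Iff_initI VWDI_inv_inv Iff_invI_swap Iff_invI_const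
          VWDI_inv_const EqRefl) auto
    then show "derives LI ?\<Gamma>
        (Iff (Strict initI (Var 0) (invI (Var 1))) (Strict initI (Var 0) (cI (rev t))))"
      by (rule Iff_mp[OF derives_mono H]) (auto simp: shift_VWDI)
  qed
  \<comment> \<open>The same cancellations turn the conclusion about \<open>f x\<close> and
    \<open>rev t\<close> into one about \<open>x\<close> and \<open>t\<close>.\<close>
  have concl: "derivesI (Iff ?C' ?C)"
    using Iff_invI_const[of "Var 0" "rev t"]
    by (intro Iff_Conjs Iff_Imp Iff_And Iff_initI EqRefl VWDI_inv_inv inv_t) auto
  show "derives LI (insert ?S (axms VWDI)) ?C"
    by (rule Iff_mp[OF derives_insert[OF concl] ImpE[OF derives_insert[OF imp] below]])
qed

text \<open>Distinctness of constants, the prefix scheme and antisymmetry become axioms of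
  \<open>VWDI\<close> verbatim; the other three schemes are the lemmas just proved.\<close>

lemma VWDI_direct_axms:
  assumes "\<phi> \<in> axms VW0"
  shows "derivesI (direct \<phi>)"
proof -
  have c0: "direct_tm (c0 s) = cI s" for s by (simp add: c0_def)
  show ?thesis
    using assms VWDI_neq VWDI_prefix VWDI_AllI[OF VWDI_suffix] VWDI_same_below_init
      VWDI_same_below_end VWDI_antisym
    unfolding VW0_def
    by (auto simp: c0 init0_def end0_def same_below_def Strict_def antisym_ax_def
        direct_Conjs direct_Disjs comp_def)
qed

section \<open>Totality of constants and assembly of the interpretation\<close>

lemma wf_VW0_axms: "\<phi> \<in> axms VW0 \<Longrightarrow> wf_fm (lang VW0) \<phi>"
  by (auto simp: VW0_def c0_def init0_def end0_def same_below_def Strict_def antisym_ax_def)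

lemma VWDI_fun_total: "derivesI (fun_total rev_translation (Const0 s) 0)"
proof -
  let ?P = "And (Neg Falsum) (Equal (Var 0) (cI s))"
  \<comment> \<open>The uniqueness clause of \<open>Exists1\<close> after the witness
    \<open>cI s\<close> has been put in for the value.\<close>
  let ?U = "Forall (Imp ?P (Equal (Var 0) (cI s)))"
  have "derives LI \<Gamma> (And (Neg Falsum) (Equal (cI s) (cI s)))" for \<Gamma>
    by (intro AndI derives_True EqRefl) simp
  moreover have "derives LI \<Gamma> ?U" for \<Gamma>
    by (intro AllI ImpI AndE2[OF Assm]) auto
  ultimately have "derives LI \<Gamma> (inst (cI s)
      (And ?P (Forall (Imp ?P (Equal (Var 0) (Var 1))))))" for \<Gamma>
    by (simp add: inst_def AndI)
  then have "derives LI \<Gamma> (Exists (And ?P (Forall (Imp ?P (Equal (Var 0) (Var 1))))))" for \<Gamma>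
    by (rule ExI[rotated 2]) auto
  then show ?thesis
    by (simp add: fun_total_def Conjs_def Exists1_def in_dom_rev)
      (simp add: rev_translation_def rename_def ImpI)
qed

theorem theorem8p2:
  shows "VW0 \<le>\<^sub>I VWDI"
proof -
  have "wf_translation (lang VW0) LI rev_translation"
  proof -
    have "wf_fm LI (rel_fm rev_translation p) \<and>
        fv_fm (rel_fm rev_translation p) \<subseteq> {0..<rel_arity (lang VW0) p}" for p
      by (cases p) (auto simp: rev_translation_def VW0_def initI_def invI_def)
    moreover have "wf_fm LI (fun_fm rev_translation f) \<and>
        fv_fm (fun_fm rev_translation f) \<subseteq> {0..fun_arity (lang VW0) f}" for f
      by (cases f) (auto simp: rev_translation_def cI_def)
    ultimately show ?thesis by (simp add: wf_translation_def rev_translation_def)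
  qed
  \<comment> \<open>The domain is nonempty by pure logic, with the free variable 0 as
    witness.\<close>
  moreover have "derivesI (Exists (dom_fm rev_translation))"
    using ExI_Var0[OF derives_True] by (simp add: rev_translation_def)
  moreover have "derivesI (fun_total rev_translation f (fun_arity (lang VW0) f))" for f
    using VWDI_fun_total by (cases f) (simp add: VW0_def)
  moreover have "derivesI (translate rev_translation \<phi>)" if "\<phi> \<in> axms VW0" for \<phi>
    using Iff_mp2[OF translate_direct[OF wf_VW0_axms[OF that]] VWDI_direct_axms[OF that]] .
  ultimately show ?thesis
    unfolding interpretable_def interpretation_of_def proves_def by blast
qed

end
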